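(* Let $\mathcal{T}_h$ be a triangulation of $\Omega=[0,1)^d$ (a finite partition into simplicial elements $T$), and let $\mathcal{U}^h_{\rm per}$ be the associated space of $\mathbb{Z}^d$-periodic continuous functions $u^h:\mathbb{R}^d\to\mathbb{R}^d$ which are affine on each $T\in\mathcal{T}_h$. Then for any $u^h\in\mathcal{U}^h_{\rm per}$ the following three subsets of $\mathbb{R}$ coincide: $$E^{\rm hqc}(u^h)=E^0(u^h)=E^{\rm mqc}(u^h),$$ where $E^{\rm hqc}(u^h)$, $E^0(u^h)$ and $E^{\rm mqc}(u^h)$ are the set-valued energies of, respectively, the homogenized quasicontinuum method, the finite element discretization of the homogenized equations, and the multilattice quasicontinuum method, as defined in the context.
   Context: **Atomistic setting.** Let $d,m\in\mathbb{N}$, and let $\epsilon>0$ with $1/\epsilon\in\mathbb{N}$. Let $\Omega=[0,1)^d$. Let $\mathcal{P}=\{p_0,\dots,p_{m-1}\}\subset[0,1)^d$ consist of $m$ distinct points with $p_0=0$. Put $\mathcal{L}=\Omega\cap\epsilon\mathbb{Z}^d$ (lattice) and $\mathcal{M}=\mathcal{L}+\epsilon\mathcal{P}$ (multilattice). The periodic extension of $\mathcal{M}$ is $\epsilon(\mathbb{Z}^d+\mathcal{P})$. For each species $\alpha\in\{0,\dots,m-1\}$ let $\mathcal{R}_\alpha\subset\mathbb{R}^d$ be a finite set (interaction neighborhood) such that $p_\alpha+r\in\mathbb{Z}^d+\mathcal{P}$ for all $r\in\mathcal{R}_\alpha$, and let $V_\alpha:(\mathbb{R}^d)^{\mathcal{R}_\alpha}\to\mathbb{R}$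 be a smooth (at least differentiable) interaction potential, whose argument is a tuple $(g_r)_{r\in\mathcal{R}_\alpha}$ of vectors of $\mathbb{R}^d$. For $r\in\mathcal{R}_\alpha$, $V'_{\alpha,r}\in\mathbb{R}^d$ denotes the gradient of $V_\alpha$ with respect to the vector variable $g_r$. For $y\in p_\alpha+\mathbb{Z}^d$ put $\mathcal{R}(y)=\mathcal{R}_\alpha$, $V(\cdot;y)=V_\alpha$, $V'_r(\cdot;y)=V'_{\alpha,r}$; for $x\in\epsilon(\mathbb{Z}^d+\mathcal{P})$ put $\mathcal{R}_\epsilon(x)=\mathcal{R}(x/\epsilon)$, $V_\epsilon(\cdot;x)=V(\cdot;x/\epsilon)$, $V'_{\epsilon,r}(\cdot;x)=V'_r(\cdot;x/\epsilon)$. **Notation.** For a finite set $S$, $\langle g(x)\rangle_{x\in S}=\frac1{\#(S)}\sum_{x\in S}g(x)$. For a function $u$ of $x\in\epsilon(\mathbb{Z}^d+\mathcal{P})$, $D_ru(x)=\frac{u(x+\epsilon r)-u(x)}{\epsilon}$; for a function $\chi$ of $y\in\mathbb{Z}^d+\mathcal{P}$, $D_{y,r}\chi(y)=\chi(y+r)-\chi(y)$. For a finite set $\mathcal{R}$ of vectors, $D_{\mathcal{R}}u=(D_ru)_{r\in\mathcal{R}}$, $D_{y,\mathcal{R}}\chi=(D_{y,r}\chi)_{r\in\mathcal{R}}$, and $\mathsf{F}\mathcal{R}=(\mathsf{F}r)_{r\in\mathcal{R}}$ for $\mathsf{F}\in\mathbb{R}^{d\times d}$. Algebraic operations on tuples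 indexed by $\mathcal{R}$ are componentwise; for a vector $q\in\mathbb{R}^d$ and a scalar function $w$, $q\,D_{\mathcal{R}}w=(q\,D_rw)_{r\in\mathcal{R}}$. The gradient $\nabla u^h|_T\in\mathbb{R}^{d\times d}$ is the constant matrix such that $(\nabla u^h|_T)r$ is the derivative of $u^h$ on $T$ in direction $r$. $|T|$ is the Lebesgue measure of $T$. For sets $A,B\subset\mathbb{R}$ and $\gamma\in\mathbb{R}$: $A+B=\{a+b:a\in A,b\in B\}$, $\gamma A=\{\gamma a:a\in A\}$. **HQC energy.** For each $T\in\mathcal{T}_h$ choose $x_T^{\rm rep}\in\mathcal{L}$ and let $S_T^{\rm rep}=x_T^{\rm rep}+\epsilon\mathcal{P}$ (sampling domain). Let $\mathcal{U}_\#(S_T^{\rm rep})$ be the space of functions $s:\epsilon(\mathbb{Z}^d+\mathcal{P})\to\mathbb{R}^d$ with $s(x+\epsilon a)=s(x)$ for all $a\in\mathbb{Z}^d$ and $\langle s\rangle_{S_T^{\rm rep}}=0$. Let $u^h_{\rm lin}$ be the affine extrapolation of $u^h|_T$ to $\mathbb{R}^d$. A function $R_T=R_T(u^h):\epsilon(\mathbb{Z}^d+\mathcal{P})\to\mathbb{R}^d$ is called a solution of the HQC microproblem on $T$ if $R_T-u^h_{\rm lin}\in\mathcal{U}_\#(S_T^{\rm rep})$ and $$\Big\langle\sum_{r\in\mathcal{R}_\epsilon(x)}V'_{\epsilon,r}\big(D_{\mathcal{R}_\epsilon(x)}R_T(x);x\big)\cdot D_rs(x)\Big\rangle_{x\in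 S_T^{\rm rep}}=0\quad\forall s\in\mathcal{U}_\#(S_T^{\rm rep}).$$ Define the sets $$e_T^{\rm hqc}(u^h)=\Big\{\big\langle V_\epsilon(D_{\mathcal{R}_\epsilon(x)}R_T(x);x)\big\rangle_{x\in S_T^{\rm rep}}: R_T\text{ is a solution of the HQC microproblem on }T\Big\},\qquad E^{\rm hqc}(u^h)=\sum_{T\in\mathcal{T}_h}|T|\,e_T^{\rm hqc}(u^h).$$ **Energy of FEM for the homogenized equations.** Let $\mathcal{U}_\#(\mathcal{P})$ be the space of $\mathbb{Z}^d$-periodic functions $\sigma:\mathbb{Z}^d+\mathcal{P}\to\mathbb{R}^d$ with $\langle\sigma\rangle_{\mathcal{P}}=0$. For $\mathsf{F}\in\mathbb{R}^{d\times d}$, a solution of the cell problem for $\mathsf{F}$ is $\chi\in\mathcal{U}_\#(\mathcal{P})$ such that $$\Big\langle\sum_{r\in\mathcal{R}(y)}V'_r\big(\mathsf{F}\mathcal{R}(y)+D_{y,\mathcal{R}(y)}\chi(y);y\big)\cdot D_{y,r}\sigma(y)\Big\rangle_{y\in\mathcal{P}}=0\quad\forall\sigma\in\mathcal{U}_\#(\mathcal{P}).$$ Define the sets $$\Phi^0(\mathsf{F})=\Big\{\big\langle V(\mathsf{F}\mathcal{R}(y)+D_{y,\mathcal{R}(y)}\chi(y);y)\big\rangle_{y\in\mathcal{P}}:\chi\text{ is a solution of the cell problem for }\mathsf{F}\Big\},\qquad E^0(u^h)=\sum_{T\in\mathcal{T}_h}|T|\,\Phi^0(\nabla u^h|_T).$$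 **MQC energy.** For $\alpha=0,\dots,m-1$ let $w_\alpha:\epsilon(\mathbb{Z}^d+\mathcal{P})\to\mathbb{R}$ be given by $w_\alpha(x)=\delta_{\alpha\beta}$ for $x\in\epsilon\mathbb{Z}^d+\epsilon p_\beta$, $\beta=0,\dots,m-1$ (Kronecker delta). For $T\in\mathcal{T}_h$ and $\mathbf{q}=(q_1,\dots,q_{m-1})\in(\mathbb{R}^d)^{m-1}$ (the values on $T$ of the piecewise constant shift vectors) put $$G_{T,\beta}(\mathbf{q})=(\nabla u^h|_T)\mathcal{R}_\beta+\sum_{\alpha=1}^{m-1}q_\alpha\,D_{\mathcal{R}_\beta}w_\alpha(\epsilon p_\beta).$$ $\mathbf{q}$ is a solution of the shift-vector equations on $T$ if $$\frac1m\sum_{\beta=0}^{m-1}\sum_{r\in\mathcal{R}_\beta}V'_{\beta,r}\big(G_{T,\beta}(\mathbf{q})\big)\,D_rw_\gamma(\epsilon p_\beta)=0\in\mathbb{R}^d\qquad(\gamma=1,\dots,m-1).$$ Define the sets $$e_T^{\rm mqc}(u^h)=\Big\{\frac1m\sum_{\beta=0}^{m-1}V_\beta\big(G_{T,\beta}(\mathbf{q})\big):\mathbf{q}\text{ is a solution of the shift-vector equations on }T\Big\},\qquad E^{\rm mqc}(u^h)=\sum_{T\in\mathcal{T}_h}|T|\,e_T^{\rm mqc}(u^h).$$ The energies are sets because the microproblems may have several (or no) solutions, and all combinations of solutions over the elements are allowed. *)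

theory Defs
  imports "HOL-Analysis.Analysis"
begin

section \<open>Lattices and species\<close>

definition int_lattice :: "(real^'d) set"
  where "int_lattice = {z. \<forall>i. z $ i \<in> \<int>}"

definition unit_cell :: "(real^'d) set"
  where "unit_cell = {x. \<forall>i. 0 \<le> x $ i \<and> x $ i < 1}"

abbreviation scale_set :: "real \<Rightarrow> 'a::real_vector set \<Rightarrow> 'a set"
  where "scale_set c A \<equiv> (*\<^sub>R) c ` A"

text \<open>The species are the indices below \<^term>\<open>m\<close>, and species \<^term>\<open>\<alpha>\<close> sits at
  \<^term>\<open>p \<alpha>\<close>; values of \<^term>\<open>p\<close> (and of all other species-indexed families) at indices
  \<open>\<ge> m\<close> are never used.\<close>

definition base_points :: "nat \<Rightarrow> (nat \<Rightarrow> real^'d) \<Rightarrow> (real^'d) set"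
  where "base_points m p = p ` {..<m}"

definition sites :: "nat \<Rightarrow> (nat \<Rightarrow> real^'d) \<Rightarrow> (real^'d) set"
  where "sites m p = int_lattice + base_points m p"

definition lattice :: "real \<Rightarrow> (real^'d) set"
  where "lattice \<epsilon> = unit_cell \<inter> scale_set \<epsilon> int_lattice"

text \<open>Well defined on \<^term>\<open>sites m p\<close> when the \<^term>\<open>p \<alpha>\<close> are distinct points of the
  unit cell, since they are then pairwise incongruent modulo the integer lattice.\<close>

definition species :: "nat \<Rightarrow> (nat \<Rightarrow> real^'d) \<Rightarrow> real^'d \<Rightarrow> nat"
  where "species m p y = (THE \<alpha>. \<alpha> < m \<and> y - p \<alpha> \<in> int_lattice)"

section \<open>Averages and difference quotients\<close>

definition average :: "'a set \<Rightarrow> ('a \<Rightarrow> 'b::real_vector) \<Rightarrow> 'b"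
  where "average S g = (1 / real (card S)) *\<^sub>R (\<Sum>x\<in>S. g x)"

definition diff_quot :: "real \<Rightarrow> real^'d \<Rightarrow> (real^'d \<Rightarrow> 'b::real_vector) \<Rightarrow> real^'d \<Rightarrow> 'b"
  where "diff_quot \<epsilon> r u x = (1 / \<epsilon>) *\<^sub>R (u (x + \<epsilon> *\<^sub>R r) - u x)"

definition cell_diff :: "real^'d \<Rightarrow> (real^'d \<Rightarrow> 'b::ab_group_add) \<Rightarrow> real^'d \<Rightarrow> 'b"
  where "cell_diff r \<phi> y = \<phi> (y + r) - \<phi> y"

section \<open>Potentials of tuples of vectors\<close>

text \<open>A tuple \<open>(g\<^sub>r)\<close> indexed by a finite set \<open>R\<close> is an element of \<open>R \<rightarrow>\<^sub>E UNIV\<close>, so a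
  potential is a function whose values outside \<open>R \<rightarrow>\<^sub>E UNIV\<close> play no role. These tuples do not
  form a type, so (joint, Frechet) differentiability with respect to the Euclidean norm of the
  tuple is spelled out.\<close>

definition tuple_differentiable ::
    "'a set \<Rightarrow> (('a \<Rightarrow> 'b::real_inner) \<Rightarrow> real) \<Rightarrow> bool"
  where "tuple_differentiable R W \<longleftrightarrow>
    (\<forall>g \<in> R \<rightarrow>\<^sub>E UNIV. \<exists>A. \<forall>e>0. \<exists>\<delta>>0. \<forall>h \<in> R \<rightarrow>\<^sub>E UNIV.
       L2_set (\<lambda>r. norm (h r)) R < \<delta> \<longrightarrow>
       \<bar>W (\<lambda>r\<in>R. g r + h r) - W g - (\<Sum>r\<in>R. A r \<bullet> h r)\<bar> \<le> e * L2_set (\<lambda>r. norm (h r)) R)"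

definition partial_grad :: "(('a \<Rightarrow> 'b::real_inner) \<Rightarrow> real) \<Rightarrow> 'a \<Rightarrow> ('a \<Rightarrow> 'b) \<Rightarrow> 'b"
  where "partial_grad W r g = (THE D. GDERIV (\<lambda>v. W (g(r := v))) (g r) :> D)"

section \<open>Triangulations and finite element functions\<close>

text \<open>A finite partition of the unit cell into simplicial elements. Each element is a
  full-dimensional simplex with any part of its boundary included or left out, and the elements
  cover the unit cell up to boundaries. Thus a partition of the half-open cell into
  disjoint pieces and the usual closed simplices with disjoint interiors are both instances, and
  elements are not required to meet in common faces.\<close>

definition unit_cell_triangulation :: "(real^'d) set set \<Rightarrow> bool"
  where "unit_cell_triangulation \<T> \<longleftrightarrow>
    finite \<T> \<and>
    (\<forall>T\<in>\<T>. int CARD('d) simplex (closure T) \<and> interior (closure T) \<subseteq> T) \<and>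
    (\<forall>T\<in>\<T>. \<forall>T'\<in>\<T>. T \<noteq> T' \<longrightarrow> interior T \<inter> interior T' = {}) \<and>
    closure (\<Union>\<T>) = closure unit_cell"

definition affine_fun_on :: "'a::real_vector set \<Rightarrow> ('a \<Rightarrow> 'b::real_vector) \<Rightarrow> bool"
  where "affine_fun_on S f \<longleftrightarrow> (\<exists>L c. linear L \<and> (\<forall>x\<in>S. f x = L x + c))"

definition fe_space :: "(real^'d) set set \<Rightarrow> (real^'d \<Rightarrow> real^'d) set"
  where "fe_space \<T> = {u. continuous_on UNIV u \<and>
    (\<forall>x. \<forall>a\<in>int_lattice. u (x + a) = u x) \<and> (\<forall>T\<in>\<T>. affine_fun_on T u)}"

definition elem_grad :: "(real^'d) set \<Rightarrow> (real^'d \<Rightarrow> real^'d) \<Rightarrow> real^'d^'d"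
  where "elem_grad T u = (THE A. \<forall>x\<in>T. (u has_derivative (\<lambda>r. A *v r)) (at x within T))"

definition affine_ext :: "(real^'d) set \<Rightarrow> (real^'d \<Rightarrow> real^'d) \<Rightarrow> real^'d \<Rightarrow> real^'d"
  where "affine_ext T u = (THE v. affine_fun_on UNIV v \<and> (\<forall>x\<in>T. v x = u x))"

text \<open>The total energy collects one choice of local energy per element: the sum is the Minkowski
  sum of sets, and \<^term>\<open>(*o)\<close> scales a set.\<close>

definition total_energy ::
    "(real^'d) set set \<Rightarrow> ((real^'d) set \<Rightarrow> real set) \<Rightarrow> real set"
  where "total_energy \<T> e = (\<Sum>T\<in>\<T>. measure lebesgue T *o e T)"

section \<open>Homogenized quasicontinuum method\<close>

text \<open>Functions on a lattice or multilattice are total functions constrained only at its sites.\<close>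

definition sampling_domain :: "real \<Rightarrow> nat \<Rightarrow> (nat \<Rightarrow> real^'d) \<Rightarrow> real^'d \<Rightarrow> (real^'d) set"
  where "sampling_domain \<epsilon> m p xr = {xr} + scale_set \<epsilon> (base_points m p)"

definition hqc_space ::
    "real \<Rightarrow> nat \<Rightarrow> (nat \<Rightarrow> real^'d) \<Rightarrow> real^'d \<Rightarrow> (real^'d \<Rightarrow> real^'d) set"
  where "hqc_space \<epsilon> m p xr = {s.
    (\<forall>x \<in> scale_set \<epsilon> (sites m p). \<forall>a \<in> int_lattice. s (x + \<epsilon> *\<^sub>R a) = s x) \<and>
    average (sampling_domain \<epsilon> m p xr) s = 0}"

definition hqc_tuple ::
    "real \<Rightarrow> nat \<Rightarrow> (nat \<Rightarrow> real^'d) \<Rightarrow> (nat \<Rightarrow> (real^'d) set) \<Rightarrow>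
     (real^'d \<Rightarrow> real^'d) \<Rightarrow> real^'d \<Rightarrow> real^'d \<Rightarrow> real^'d"
  where "hqc_tuple \<epsilon> m p \<R> u x = (\<lambda>r \<in> \<R> (species m p (x /\<^sub>R \<epsilon>)). diff_quot \<epsilon> r u x)"

definition hqc_solution ::
    "real \<Rightarrow> nat \<Rightarrow> (nat \<Rightarrow> real^'d) \<Rightarrow> (nat \<Rightarrow> (real^'d) set) \<Rightarrow>
     (nat \<Rightarrow> (real^'d \<Rightarrow> real^'d) \<Rightarrow> real) \<Rightarrow> (real^'d \<Rightarrow> real^'d) \<Rightarrow>
     (real^'d) set \<Rightarrow> real^'d \<Rightarrow> (real^'d \<Rightarrow> real^'d) \<Rightarrow> bool"
  where "hqc_solution \<epsilon> m p \<R> V u T xr RT \<longleftrightarrow>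
    (\<lambda>x. RT x - affine_ext T u x) \<in> hqc_space \<epsilon> m p xr \<and>
    (\<forall>s \<in> hqc_space \<epsilon> m p xr.
       average (sampling_domain \<epsilon> m p xr)
         (\<lambda>x. \<Sum>r \<in> \<R> (species m p (x /\<^sub>R \<epsilon>)).
            partial_grad (V (species m p (x /\<^sub>R \<epsilon>))) r (hqc_tuple \<epsilon> m p \<R> RT x)
              \<bullet> diff_quot \<epsilon> r s x) = 0)"

definition hqc_elem_energy ::
    "real \<Rightarrow> nat \<Rightarrow> (nat \<Rightarrow> real^'d) \<Rightarrow> (nat \<Rightarrow> (real^'d) set) \<Rightarrow>
     (nat \<Rightarrow> (real^'d \<Rightarrow> real^'d) \<Rightarrow> real) \<Rightarrow> (real^'d \<Rightarrow> real^'d) \<Rightarrow>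
     (real^'d) set \<Rightarrow> real^'d \<Rightarrow> real set"
  where "hqc_elem_energy \<epsilon> m p \<R> V u T xr =
    {average (sampling_domain \<epsilon> m p xr)
       (\<lambda>x. V (species m p (x /\<^sub>R \<epsilon>)) (hqc_tuple \<epsilon> m p \<R> RT x)) | RT.
     hqc_solution \<epsilon> m p \<R> V u T xr RT}"

definition E_hqc ::
    "real \<Rightarrow> nat \<Rightarrow> (nat \<Rightarrow> real^'d) \<Rightarrow> (nat \<Rightarrow> (real^'d) set) \<Rightarrow>
     (nat \<Rightarrow> (real^'d \<Rightarrow> real^'d) \<Rightarrow> real) \<Rightarrow> (real^'d) set set \<Rightarrow>
     ((real^'d) set \<Rightarrow> real^'d) \<Rightarrow> (real^'d \<Rightarrow> real^'d) \<Rightarrow> real set"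
  where "E_hqc \<epsilon> m p \<R> V \<T> xrep u =
    total_energy \<T> (\<lambda>T. hqc_elem_energy \<epsilon> m p \<R> V u T (xrep T))"

section \<open>Homogenized equations\<close>

definition cell_space :: "nat \<Rightarrow> (nat \<Rightarrow> real^'d) \<Rightarrow> (real^'d \<Rightarrow> real^'d) set"
  where "cell_space m p = {\<sigma>.
    (\<forall>y \<in> sites m p. \<forall>a \<in> int_lattice. \<sigma> (y + a) = \<sigma> y) \<and>
    average (base_points m p) \<sigma> = 0}"

definition cell_tuple ::
    "nat \<Rightarrow> (nat \<Rightarrow> real^'d) \<Rightarrow> (nat \<Rightarrow> (real^'d) set) \<Rightarrow> real^'d^'d \<Rightarrow>
     (real^'d \<Rightarrow> real^'d) \<Rightarrow> real^'d \<Rightarrow> real^'d \<Rightarrow> real^'d"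
  where "cell_tuple m p \<R> F \<phi> y = (\<lambda>r \<in> \<R> (species m p y). F *v r + cell_diff r \<phi> y)"

definition cell_solution ::
    "nat \<Rightarrow> (nat \<Rightarrow> real^'d) \<Rightarrow> (nat \<Rightarrow> (real^'d) set) \<Rightarrow>
     (nat \<Rightarrow> (real^'d \<Rightarrow> real^'d) \<Rightarrow> real) \<Rightarrow> real^'d^'d \<Rightarrow> (real^'d \<Rightarrow> real^'d) \<Rightarrow> bool"
  where "cell_solution m p \<R> V F \<phi> \<longleftrightarrow>
    \<phi> \<in> cell_space m p \<and>
    (\<forall>\<sigma> \<in> cell_space m p.
       average (base_points m p)
         (\<lambda>y. \<Sum>r \<in> \<R> (species m p y).
            partial_grad (V (species m p y)) r (cell_tuple m p \<R> F \<phi> y)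
              \<bullet> cell_diff r \<sigma> y) = 0)"

definition hom_energy_density ::
    "nat \<Rightarrow> (nat \<Rightarrow> real^'d) \<Rightarrow> (nat \<Rightarrow> (real^'d) set) \<Rightarrow>
     (nat \<Rightarrow> (real^'d \<Rightarrow> real^'d) \<Rightarrow> real) \<Rightarrow> real^'d^'d \<Rightarrow> real set"
  where "hom_energy_density m p \<R> V F =
    {average (base_points m p) (\<lambda>y. V (species m p y) (cell_tuple m p \<R> F \<phi> y)) | \<phi>.
     cell_solution m p \<R> V F \<phi>}"

definition E_hom ::
    "nat \<Rightarrow> (nat \<Rightarrow> real^'d) \<Rightarrow> (nat \<Rightarrow> (real^'d) set) \<Rightarrow>
     (nat \<Rightarrow> (real^'d \<Rightarrow> real^'d) \<Rightarrow> real) \<Rightarrow> (real^'d) set set \<Rightarrow>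
     (real^'d \<Rightarrow> real^'d) \<Rightarrow> real set"
  where "E_hom m p \<R> V \<T> u =
    total_energy \<T> (\<lambda>T. hom_energy_density m p \<R> V (elem_grad T u))"

section \<open>Multilattice quasicontinuum method\<close>

definition species_indicator ::
    "real \<Rightarrow> nat \<Rightarrow> (nat \<Rightarrow> real^'d) \<Rightarrow> nat \<Rightarrow> real^'d \<Rightarrow> real"
  where "species_indicator \<epsilon> m p \<alpha> x = (if species m p (x /\<^sub>R \<epsilon>) = \<alpha> then 1 else 0)"

text \<open>The shift vectors are \<open>q 1, \<dots>, q (m - 1)\<close>; other values of \<^term>\<open>q\<close> are never used.\<close>

definition mqc_tuple ::
    "real \<Rightarrow> nat \<Rightarrow> (nat \<Rightarrow> real^'d) \<Rightarrow> (nat \<Rightarrow> (real^'d) set) \<Rightarrow> real^'d^'d \<Rightarrow>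
     nat \<Rightarrow> (nat \<Rightarrow> real^'d) \<Rightarrow> real^'d \<Rightarrow> real^'d"
  where "mqc_tuple \<epsilon> m p \<R> F \<beta> q =
    (\<lambda>r \<in> \<R> \<beta>. F *v r +
       (\<Sum>\<alpha> = 1..<m. diff_quot \<epsilon> r (species_indicator \<epsilon> m p \<alpha>) (\<epsilon> *\<^sub>R p \<beta>) *\<^sub>R q \<alpha>))"

definition mqc_solution ::
    "real \<Rightarrow> nat \<Rightarrow> (nat \<Rightarrow> real^'d) \<Rightarrow> (nat \<Rightarrow> (real^'d) set) \<Rightarrow>
     (nat \<Rightarrow> (real^'d \<Rightarrow> real^'d) \<Rightarrow> real) \<Rightarrow> real^'d^'d \<Rightarrow> (nat \<Rightarrow> real^'d) \<Rightarrow> bool"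
  where "mqc_solution \<epsilon> m p \<R> V F q \<longleftrightarrow>
    (\<forall>\<gamma> \<in> {1..<m}.
       (1 / real m) *\<^sub>R (\<Sum>\<beta><m. \<Sum>r \<in> \<R> \<beta>.
          diff_quot \<epsilon> r (species_indicator \<epsilon> m p \<gamma>) (\<epsilon> *\<^sub>R p \<beta>) *\<^sub>R
            partial_grad (V \<beta>) r (mqc_tuple \<epsilon> m p \<R> F \<beta> q)) = 0)"

definition mqc_elem_energy ::
    "real \<Rightarrow> nat \<Rightarrow> (nat \<Rightarrow> real^'d) \<Rightarrow> (nat \<Rightarrow> (real^'d) set) \<Rightarrow>
     (nat \<Rightarrow> (real^'d \<Rightarrow> real^'d) \<Rightarrow> real) \<Rightarrow> real^'d^'d \<Rightarrow> real set"
  where "mqc_elem_energy \<epsilon> m p \<R> V F =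
    {(1 / real m) * (\<Sum>\<beta><m. V \<beta> (mqc_tuple \<epsilon> m p \<R> F \<beta> q)) | q.
     mqc_solution \<epsilon> m p \<R> V F q}"

definition E_mqc ::
    "real \<Rightarrow> nat \<Rightarrow> (nat \<Rightarrow> real^'d) \<Rightarrow> (nat \<Rightarrow> (real^'d) set) \<Rightarrow>
     (nat \<Rightarrow> (real^'d \<Rightarrow> real^'d) \<Rightarrow> real) \<Rightarrow> (real^'d) set set \<Rightarrow>
     (real^'d \<Rightarrow> real^'d) \<Rightarrow> real set"
  where "E_mqc \<epsilon> m p \<R> V \<T> u =
    total_energy \<T> (\<lambda>T. mqc_elem_energy \<epsilon> m p \<R> V (elem_grad T u))"

end

theory Submission
  imports Defs
begin

text \<open>Each of the three energies is a Minkowski sum of element contributions with the same weights,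
  so it suffices to compare the contributions of one element. On an element, all three local
  problems are the same finite system in different coordinates. A lattice-periodic function on the
  multilattice is determined by one value per species, and a difference from a site of species
  \<open>\<beta>\<close> in direction \<open>r\<close> is the difference of the values at species \<open>\<beta>\<close> and at the species of the
  neighbour. In the unknown \<open>c\<close> of species displacements, the argument of the potential is
  \<open>F r + (c (neighbour_species \<beta> r) - c \<beta>)\<close>, where \<open>F\<close> is the gradient on the element, and the
  equation says that the first variation vanishes for all species-valued test functions. The
  resulting set of critical energies is \<open>reduced_energies\<close>.

  The coordinates differ in scale and in normalisation. The cell problem uses \<open>\<chi> = c\<close>, the
  microproblem the perturbation \<open>\<epsilon> c\<close> of the affine extension, and the shift vectors are \<open>\<epsilon> c\<close> as
  well. The first two normalise \<open>c\<close> to have mean zero, the third to vanish on species \<open>0\<close>. Since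
  only differences enter, a constant may be added to \<open>c\<close> and to the test functions, so the
  normalisations do not matter. The three identifications are \<open>hom_energy_density_eq_reduced\<close>,
  \<open>hqc_elem_energy_eq_reduced\<close> and \<open>mqc_elem_energy_eq_reduced\<close>. The gradients of the potentials
  are evaluated at equal tuples, so they agree term by term.

  The microproblem refers to the affine extension of the finite element function and the other two
  to its gradient. Because an element has interior points, both are determined by the values on
  the element, and the linear part of the former is the latter (\<open>fe_function_on_element\<close>).\<close>

section \<open>Integer translations and species\<close>

lemma zero_in_int_lattice: "0 \<in> int_lattice"
  by (simp add: int_lattice_def)

lemma add_in_int_lattice: "a \<in> int_lattice \<Longrightarrow> b \<in> int_lattice \<Longrightarrow> a + b \<in> int_lattice"
  by (simp add: int_lattice_def)

lemma diff_in_int_lattice: "a \<in> int_lattice \<Longrightarrow> b \<in> int_lattice \<Longrightarrow> a - b \<in> int_lattice"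
  by (simp add: int_lattice_def)

text \<open>Congruent points of the unit cell differ by a vector whose entries are integers of absolute
  value less than one.\<close>

lemma unit_cell_congruent_eq:
  assumes "x \<in> unit_cell" "y \<in> unit_cell" "x - y \<in> int_lattice"
  shows "x = y"
proof -
  have "x $ i = y $ i" for i
  proof -
    have "x $ i - y $ i \<in> \<int>"
      using assms(3) by (simp add: int_lattice_def)
    moreover have "\<bar>x $ i - y $ i\<bar> < 1"
    proof -
      have "0 \<le> x $ i" "x $ i < 1" "0 \<le> y $ i" "y $ i < 1"
        using assms(1,2) by (auto simp: unit_cell_def)
      then show ?thesis by linarith
    qed
    ultimately show ?thesis
      using Ints_nonzero_abs_less1 by fastforce
  qed
  then show ?thesis
    by (simp add: vec_eq_iff)
qed

locale multilattice =
  fixes m :: nat and p :: "nat \<Rightarrow> real^'d" and \<R> :: "nat \<Rightarrow> (real^'d) set"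
  assumes m_pos: "m > 0"
    and inj_p: "inj_on p {..<m}"
    and p_cell: "\<alpha> < m \<Longrightarrow> p \<alpha> \<in> unit_cell"
    and neighbour_site: "\<alpha> < m \<Longrightarrow> r \<in> \<R> \<alpha> \<Longrightarrow> p \<alpha> + r \<in> sites m p"
begin

lemma species_eqI:
  assumes "\<alpha> < m" "y - p \<alpha> \<in> int_lattice"
  shows "species m p y = \<alpha>"
  unfolding species_def
proof (rule the_equality)
  fix \<beta> assume \<beta>: "\<beta> < m \<and> y - p \<beta> \<in> int_lattice"
  then have "p \<beta> - p \<alpha> \<in> int_lattice"
    using diff_in_int_lattice[OF assms(2), of "y - p \<beta>"] by simp
  then have "p \<beta> = p \<alpha>"
    using \<beta> assms(1) by (intro unit_cell_congruent_eq p_cell) auto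
  then show "\<beta> = \<alpha>"
    using \<beta> assms(1) inj_onD[OF inj_p] by auto
qed (use assms in simp)

lemma species_translate: "\<alpha> < m \<Longrightarrow> a \<in> int_lattice \<Longrightarrow> species m p (a + p \<alpha>) = \<alpha>"
  by (rule species_eqI) auto

lemma sites_cases:
  assumes "y \<in> sites m p"
  obtains a \<alpha> where "a \<in> int_lattice" "\<alpha> < m" "y = a + p \<alpha>"
  using assms by (auto simp: sites_def base_points_def set_plus_def)

lemma species_periodic:
  assumes "y \<in> sites m p" "a \<in> int_lattice"
  shows "species m p (y + a) = species m p y"
proof -
  obtain b \<alpha> where y: "b \<in> int_lattice" "\<alpha> < m" "y = b + p \<alpha>"
    using assms(1) by (rule sites_cases)
  have "species m p ((a + b) + p \<alpha>) = \<alpha>"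
    using y assms(2) by (intro species_translate add_in_int_lattice)
  then show ?thesis
    using y by (simp add: species_translate add_ac)
qed

definition neighbour_species :: "nat \<Rightarrow> real^'d \<Rightarrow> nat"
  where "neighbour_species \<beta> r = species m p (p \<beta> + r)"

lemma neighbour_cases:
  assumes "\<beta> < m" "r \<in> \<R> \<beta>"
  obtains a where "a \<in> int_lattice" "neighbour_species \<beta> r < m"
    "p \<beta> + r = a + p (neighbour_species \<beta> r)"
proof -
  obtain a \<alpha> where "a \<in> int_lattice" "\<alpha> < m" "p \<beta> + r = a + p \<alpha>"
    using neighbour_site[OF assms] by (rule sites_cases)
  then show ?thesis
    by (intro that) (simp_all add: neighbour_species_def species_translate)
qed

text \<open>A function that is periodic on the scaled multilattice enters only through its values on one
  translate of the scaled base points: at a neighbour of a site it has the value of the base point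
  of the neighbour's species.\<close>

lemma periodic_at_neighbour:
  assumes per: "\<forall>x \<in> scale_set \<epsilon> (sites m p). \<forall>a \<in> int_lattice. f (x + \<epsilon> *\<^sub>R a) = f x"
    and z: "z \<in> int_lattice" and \<beta>: "\<beta> < m" "r \<in> \<R> \<beta>"
  shows "f (\<epsilon> *\<^sub>R z + \<epsilon> *\<^sub>R p \<beta> + \<epsilon> *\<^sub>R r)
    = f (\<epsilon> *\<^sub>R z + \<epsilon> *\<^sub>R p (neighbour_species \<beta> r))"
proof -
  obtain a where a: "a \<in> int_lattice" and lt: "neighbour_species \<beta> r < m"
    and eq: "p \<beta> + r = a + p (neighbour_species \<beta> r)"
    using neighbour_cases[OF \<beta>] .
  have "z + p (neighbour_species \<beta> r) \<in> sites m p"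
    using z lt by (auto simp: sites_def base_points_def)
  then have "f (\<epsilon> *\<^sub>R (z + p (neighbour_species \<beta> r)) + \<epsilon> *\<^sub>R a)
      = f (\<epsilon> *\<^sub>R (z + p (neighbour_species \<beta> r)))"
    using per a by blast
  moreover have "\<epsilon> *\<^sub>R (z + p (neighbour_species \<beta> r)) + \<epsilon> *\<^sub>R a = \<epsilon> *\<^sub>R z + \<epsilon> *\<^sub>R (p \<beta> + r)"
    unfolding eq by (simp add: scaleR_add_right add_ac)
  ultimately show ?thesis
    by (simp add: scaleR_add_right add.assoc)
qed

lemma average_base_points:
  "average (base_points m p) g = (1 / real m) *\<^sub>R (\<Sum>\<beta><m. g (p \<beta>))"
  using inj_p by (simp add: average_def base_points_def card_image sum.reindex)

lemma average_sampling_domain: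
  assumes "\<epsilon> > 0"
  shows "average (sampling_domain \<epsilon> m p x) g
    = (1 / real m) *\<^sub>R (\<Sum>\<beta><m. g (x + \<epsilon> *\<^sub>R p \<beta>))"
proof -
  have "sampling_domain \<epsilon> m p x = (\<lambda>\<beta>. x + \<epsilon> *\<^sub>R p \<beta>) ` {..<m}"
    by (auto simp: sampling_domain_def base_points_def set_plus_def)
  moreover have "inj_on (\<lambda>\<beta>. x + \<epsilon> *\<^sub>R p \<beta>) {..<m}"
    using inj_p assms by (auto simp: inj_on_def)
  ultimately show ?thesis
    by (simp add: average_def card_image sum.reindex)
qed

section \<open>The reduced problem for species displacements\<close>

definition reduced_tuple :: "real^'d^'d \<Rightarrow> (nat \<Rightarrow> real^'d) \<Rightarrow> nat \<Rightarrow> real^'d \<Rightarrow> real^'d"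
  where "reduced_tuple F c \<beta> =
    (\<lambda>r \<in> \<R> \<beta>. F *v r + (c (neighbour_species \<beta> r) - c \<beta>))"

definition reduced_variation ::
    "(nat \<Rightarrow> (real^'d \<Rightarrow> real^'d) \<Rightarrow> real) \<Rightarrow> real^'d^'d \<Rightarrow>
     (nat \<Rightarrow> real^'d) \<Rightarrow> (nat \<Rightarrow> real^'d) \<Rightarrow> real"
  where "reduced_variation V F c s =
    (\<Sum>\<beta><m. \<Sum>r \<in> \<R> \<beta>.
       partial_grad (V \<beta>) r (reduced_tuple F c \<beta>) \<bullet> (s (neighbour_species \<beta> r) - s \<beta>))"

text \<open>Neither the displacements nor the test values are normalised here: both enter through
  differences only, so each of the three methods may fix its own additive constant.\<close>

definition reduced_energies ::
    "(nat \<Rightarrow> (real^'d \<Rightarrow> real^'d) \<Rightarrow> real) \<Rightarrow> real^'d^'d \<Rightarrow> real set"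
  where "reduced_energies V F =
    {(1 / real m) * (\<Sum>\<beta><m. V \<beta> (reduced_tuple F c \<beta>)) | c.
     \<forall>s. reduced_variation V F c s = 0}"

lemma reduced_tuple_shift: "reduced_tuple F (\<lambda>\<alpha>. c \<alpha> - v) = reduced_tuple F c"
  by (simp add: reduced_tuple_def fun_eq_iff)

text \<open>Neighbours of sites are sites, so the neighbouring species are again below \<open>m\<close>.\<close>

lemma reduced_tuple_cong:
  assumes "\<And>\<alpha>. \<alpha> < m \<Longrightarrow> c \<alpha> = c' \<alpha>" "\<beta> < m"
  shows "reduced_tuple F c \<beta> = reduced_tuple F c' \<beta>"
proof -
  have "c (neighbour_species \<beta> r) = c' (neighbour_species \<beta> r)" if "r \<in> \<R> \<beta>" for r
    using assms neighbour_cases[OF assms(2) that] by metis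
  then show ?thesis
    using assms by (auto simp: reduced_tuple_def fun_eq_iff)
qed

lemma reduced_variation_shift:
  "reduced_variation V F (\<lambda>\<alpha>. c \<alpha> - v) s = reduced_variation V F c s"
  by (simp add: reduced_variation_def reduced_tuple_shift)

lemma reduced_variation_shift_test:
  "reduced_variation V F c (\<lambda>\<alpha>. s \<alpha> - v) = reduced_variation V F c s"
  by (simp add: reduced_variation_def)

lemma reduced_variation_sum_test:
  "reduced_variation V F c (\<lambda>\<alpha>. \<Sum>\<gamma>\<in>A. s \<gamma> \<alpha>) = (\<Sum>\<gamma>\<in>A. reduced_variation V F c (s \<gamma>))"
  unfolding reduced_variation_def sum_subtractf[symmetric] inner_sum_right
  by (subst (2) sum.swap, intro sum.cong refl, subst sum.swap, simp)

lemma reduced_variation_cong: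
  assumes "\<And>\<alpha>. \<alpha> < m \<Longrightarrow> c \<alpha> = c' \<alpha>" "\<And>\<alpha>. \<alpha> < m \<Longrightarrow> s \<alpha> = s' \<alpha>"
  shows "reduced_variation V F c s = reduced_variation V F c' s'"
  unfolding reduced_variation_def
proof (intro sum.cong refl)
  fix \<beta> r assume \<beta>: "\<beta> \<in> {..<m}" and r: "r \<in> \<R> \<beta>"
  then have "neighbour_species \<beta> r < m"
    using neighbour_cases by (metis lessThan_iff)
  then show "partial_grad (V \<beta>) r (reduced_tuple F c \<beta>) \<bullet> (s (neighbour_species \<beta> r) - s \<beta>)
    = partial_grad (V \<beta>) r (reduced_tuple F c' \<beta>) \<bullet> (s' (neighbour_species \<beta> r) - s' \<beta>)"
    using \<beta> assms reduced_tuple_cong[of c c' \<beta> F] by simp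
qed

definition mean :: "(nat \<Rightarrow> real^'d) \<Rightarrow> real^'d"
  where "mean c = (1 / real m) *\<^sub>R (\<Sum>\<beta><m. c \<beta>)"

lemma mean_centred: "(\<Sum>\<beta><m. c \<beta> - mean c) = 0"
  using m_pos by (simp add: mean_def sum_subtractf sum_constant_scaleR del: sum_constant)

section \<open>The cell problem\<close>

text \<open>Subtracting the mean gives an admissible function and leaves all differences unchanged, so
  arbitrary species values, as displacements or as test values, are realised in the cell problem.\<close>

definition cell_extension :: "(nat \<Rightarrow> real^'d) \<Rightarrow> real^'d \<Rightarrow> real^'d"
  where "cell_extension c y = c (species m p y) - mean c"

lemma cell_extension_base: "\<beta> < m \<Longrightarrow> cell_extension c (p \<beta>) = c \<beta> - mean c"
  using species_translate[OF _ zero_in_int_lattice] by (simp add: cell_extension_def)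

lemma cell_extension_in_cell_space: "cell_extension c \<in> cell_space m p"
proof -
  have "(\<Sum>\<beta><m. cell_extension c (p \<beta>)) = 0"
    using mean_centred by (simp add: cell_extension_base)
  then show ?thesis
    by (simp add: cell_space_def average_base_points cell_extension_def species_periodic)
qed

lemma cell_diff_periodic:
  assumes "\<phi> \<in> cell_space m p" "\<beta> < m" "r \<in> \<R> \<beta>"
  shows "cell_diff r \<phi> (p \<beta>) = \<phi> (p (neighbour_species \<beta> r)) - \<phi> (p \<beta>)"
  using periodic_at_neighbour[of 1 \<phi> 0, OF _ zero_in_int_lattice assms(2,3)] assms(1)
  by (simp add: cell_space_def cell_diff_def)

lemma cell_tuple_eq_reduced:
  assumes "\<phi> \<in> cell_space m p" "\<beta> < m"
  shows "cell_tuple m p \<R> F \<phi> (p \<beta>) = reduced_tuple F (\<lambda>\<alpha>. \<phi> (p \<alpha>)) \<beta>"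
  using cell_diff_periodic[OF assms] species_translate[OF assms(2) zero_in_int_lattice]
  by (auto simp: cell_tuple_def reduced_tuple_def fun_eq_iff)

lemma cell_variation_eq_reduced:
  assumes "\<phi> \<in> cell_space m p" "\<sigma> \<in> cell_space m p"
  shows "average (base_points m p)
         (\<lambda>y. \<Sum>r \<in> \<R> (species m p y).
            partial_grad (V (species m p y)) r (cell_tuple m p \<R> F \<phi> y)
              \<bullet> cell_diff r \<sigma> y)
    = (1 / real m) * reduced_variation V F (\<lambda>\<alpha>. \<phi> (p \<alpha>)) (\<lambda>\<alpha>. \<sigma> (p \<alpha>))"
  using assms species_translate[OF _ zero_in_int_lattice]
  by (simp add: average_base_points reduced_variation_def cell_diff_periodic cell_tuple_eq_reduced)

lemma cell_solution_iff_reduced: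
  "cell_solution m p \<R> V F \<phi> \<longleftrightarrow>
   \<phi> \<in> cell_space m p \<and> (\<forall>s. reduced_variation V F (\<lambda>\<alpha>. \<phi> (p \<alpha>)) s = 0)" (is "_ \<longleftrightarrow> ?R")
proof
  assume sol: "cell_solution m p \<R> V F \<phi>"
  then have \<phi>: "\<phi> \<in> cell_space m p"
    by (simp add: cell_solution_def)
  have "reduced_variation V F (\<lambda>\<alpha>. \<phi> (p \<alpha>)) s = 0" for s
  proof -
    have "reduced_variation V F (\<lambda>\<alpha>. \<phi> (p \<alpha>)) (\<lambda>\<alpha>. cell_extension s (p \<alpha>)) = 0"
      using sol cell_variation_eq_reduced[OF \<phi> cell_extension_in_cell_space, of V F s]
        cell_extension_in_cell_space[of s] m_pos
      by (simp add: cell_solution_def)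
    moreover have "reduced_variation V F (\<lambda>\<alpha>. \<phi> (p \<alpha>)) (\<lambda>\<alpha>. cell_extension s (p \<alpha>))
        = reduced_variation V F (\<lambda>\<alpha>. \<phi> (p \<alpha>)) (\<lambda>\<alpha>. s \<alpha> - mean s)"
      by (rule reduced_variation_cong) (simp_all add: cell_extension_base)
    ultimately show ?thesis
      by (simp add: reduced_variation_shift_test)
  qed
  with \<phi> show ?R by simp
next
  assume ?R
  then show "cell_solution m p \<R> V F \<phi>"
    by (simp add: cell_solution_def cell_variation_eq_reduced)
qed

lemma cell_energy_eq_reduced:
  assumes "\<phi> \<in> cell_space m p"
  shows "average (base_points m p) (\<lambda>y. V (species m p y) (cell_tuple m p \<R> F \<phi> y))
    = (1 / real m) * (\<Sum>\<beta><m. V \<beta> (reduced_tuple F (\<lambda>\<alpha>. \<phi> (p \<alpha>)) \<beta>))"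
  using assms species_translate[OF _ zero_in_int_lattice]
  by (simp add: average_base_points cell_tuple_eq_reduced)

lemma hom_energy_density_eq_reduced: "hom_energy_density m p \<R> V F = reduced_energies V F"
proof (intro equalityI subsetI)
  fix E assume "E \<in> hom_energy_density m p \<R> V F"
  then obtain \<phi> where "cell_solution m p \<R> V F \<phi>"
    and "E = average (base_points m p) (\<lambda>y. V (species m p y) (cell_tuple m p \<R> F \<phi> y))"
    by (auto simp: hom_energy_density_def)
  then show "E \<in> reduced_energies V F"
    by (auto simp: reduced_energies_def cell_solution_iff_reduced cell_energy_eq_reduced)
next
  fix E assume "E \<in> reduced_energies V F"
  then obtain c where c: "\<forall>s. reduced_variation V F c s = 0"
    and E: "E = (1 / real m) * (\<Sum>\<beta><m. V \<beta> (reduced_tuple F c \<beta>))"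
    by (auto simp: reduced_energies_def)
  let ?\<phi> = "cell_extension c"
  have "reduced_variation V F (\<lambda>\<alpha>. ?\<phi> (p \<alpha>)) s = reduced_variation V F (\<lambda>\<alpha>. c \<alpha> - mean c) s" for s
    by (rule reduced_variation_cong) (simp_all add: cell_extension_base)
  then have "cell_solution m p \<R> V F ?\<phi>"
    using c by (simp add: cell_solution_iff_reduced cell_extension_in_cell_space
        reduced_variation_shift)
  moreover have "reduced_tuple F (\<lambda>\<alpha>. ?\<phi> (p \<alpha>)) \<beta> = reduced_tuple F c \<beta>" if "\<beta> < m" for \<beta>
    using that reduced_tuple_cong[of "\<lambda>\<alpha>. ?\<phi> (p \<alpha>)" "\<lambda>\<alpha>. c \<alpha> - mean c" \<beta>]
    by (simp add: cell_extension_base reduced_tuple_shift)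
  then have "E = average (base_points m p)
      (\<lambda>y. V (species m p y) (cell_tuple m p \<R> F ?\<phi> y))"
    by (simp add: E cell_energy_eq_reduced cell_extension_in_cell_space)
  ultimately show "E \<in> hom_energy_density m p \<R> V F"
    unfolding hom_energy_density_def by blast
qed

section \<open>The microproblem on a sampling domain\<close>

text \<open>Species values \<open>c\<close> correspond to the perturbation \<open>\<epsilon> c\<close>, since difference quotients divide
  by \<open>\<epsilon>\<close> while differences in the cell problem do not.\<close>

lemma scaled_cell_extension_in_hqc_space:
  assumes "\<epsilon> > 0" "z \<in> int_lattice"
  shows "(\<lambda>x. \<epsilon> *\<^sub>R cell_extension c (x /\<^sub>R \<epsilon>)) \<in> hqc_space \<epsilon> m p (\<epsilon> *\<^sub>R z)"
proof -
  have "cell_extension c (z + p \<beta>) = c \<beta> - mean c" if "\<beta> < m" for \<beta>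
    using that assms(2) by (simp add: cell_extension_def species_translate)
  then have "(\<Sum>\<beta><m. cell_extension c (z + p \<beta>)) = 0"
    using mean_centred by simp
  then show ?thesis
    using assms(1)
    by (simp add: hqc_space_def average_sampling_domain scaleR_add_right[of "inverse \<epsilon>"]
        cell_extension_def species_periodic flip: scaleR_sum_right)
qed

definition site_values :: "real \<Rightarrow> real^'d \<Rightarrow> (real^'d \<Rightarrow> real^'d) \<Rightarrow> nat \<Rightarrow> real^'d"
  where "site_values \<epsilon> z s \<alpha> = s (\<epsilon> *\<^sub>R z + \<epsilon> *\<^sub>R p \<alpha>) /\<^sub>R \<epsilon>"

lemma site_values_scaled_cell_extension:
  assumes "\<epsilon> > 0" "z \<in> int_lattice" "\<alpha> < m"
  shows "site_values \<epsilon> z (\<lambda>x. \<epsilon> *\<^sub>R cell_extension c (x /\<^sub>R \<epsilon>)) \<alpha> = c \<alpha> - mean c"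
  using assms
  by (simp add: site_values_def cell_extension_def species_translate
      scaleR_add_right[of "inverse \<epsilon>"])

lemma species_sampling:
  assumes "\<epsilon> > 0" "z \<in> int_lattice" "\<beta> < m"
  shows "species m p ((\<epsilon> *\<^sub>R z + \<epsilon> *\<^sub>R p \<beta>) /\<^sub>R \<epsilon>) = \<beta>"
  using assms by (simp add: scaleR_add_right[of "inverse \<epsilon>"] species_translate)

lemma diff_quot_periodic:
  assumes "s \<in> hqc_space \<epsilon> m p (\<epsilon> *\<^sub>R z)" "z \<in> int_lattice" "\<beta> < m" "r \<in> \<R> \<beta>"
  shows "diff_quot \<epsilon> r s (\<epsilon> *\<^sub>R z + \<epsilon> *\<^sub>R p \<beta>)
    = site_values \<epsilon> z s (neighbour_species \<beta> r) - site_values \<epsilon> z s \<beta>"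
  using periodic_at_neighbour[OF _ assms(2-4), of \<epsilon> s] assms(1)
  by (simp add: hqc_space_def diff_quot_def site_values_def divide_inverse scaleR_diff_right)

text \<open>The affine part of the reconstruction contributes exactly the Cauchy-Born term \<open>F r\<close>.\<close>

lemma hqc_tuple_eq_reduced:
  assumes \<epsilon>: "\<epsilon> > 0" and z: "z \<in> int_lattice" and \<beta>: "\<beta> < m"
    and s: "(\<lambda>x. RT x - (F *v x + b)) \<in> hqc_space \<epsilon> m p (\<epsilon> *\<^sub>R z)"
  shows "hqc_tuple \<epsilon> m p \<R> RT (\<epsilon> *\<^sub>R z + \<epsilon> *\<^sub>R p \<beta>)
    = reduced_tuple F (site_values \<epsilon> z (\<lambda>x. RT x - (F *v x + b))) \<beta>"
proof -
  let ?x = "\<epsilon> *\<^sub>R z + \<epsilon> *\<^sub>R p \<beta>" and ?s = "\<lambda>x. RT x - (F *v x + b)"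
  have "diff_quot \<epsilon> r RT ?x = F *v r + diff_quot \<epsilon> r ?s ?x" for r
    using \<epsilon> by (simp add: diff_quot_def matrix_vector_right_distrib matrix_vector_mult_scaleR
        scaleR_add_right scaleR_diff_right)
  then show ?thesis
    using diff_quot_periodic[OF s z \<beta>] species_sampling[OF \<epsilon> z \<beta>]
    by (auto simp: hqc_tuple_def reduced_tuple_def fun_eq_iff)
qed

lemma hqc_variation_eq_reduced:
  assumes \<epsilon>: "\<epsilon> > 0" and z: "z \<in> int_lattice"
    and RT: "(\<lambda>x. RT x - (F *v x + b)) \<in> hqc_space \<epsilon> m p (\<epsilon> *\<^sub>R z)"
    and s: "s \<in> hqc_space \<epsilon> m p (\<epsilon> *\<^sub>R z)"
  shows "average (sampling_domain \<epsilon> m p (\<epsilon> *\<^sub>R z))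
         (\<lambda>x. \<Sum>r \<in> \<R> (species m p (x /\<^sub>R \<epsilon>)).
            partial_grad (V (species m p (x /\<^sub>R \<epsilon>))) r (hqc_tuple \<epsilon> m p \<R> RT x)
              \<bullet> diff_quot \<epsilon> r s x)
    = (1 / real m) * reduced_variation V F
        (site_values \<epsilon> z (\<lambda>x. RT x - (F *v x + b))) (site_values \<epsilon> z s)"
  by (simp add: average_sampling_domain[OF \<epsilon>] reduced_variation_def species_sampling[OF \<epsilon> z]
      diff_quot_periodic[OF s z] hqc_tuple_eq_reduced[OF \<epsilon> z _ RT])

lemma hqc_solution_iff_reduced:
  assumes \<epsilon>: "\<epsilon> > 0" and z: "z \<in> int_lattice" and ext: "affine_ext T u = (\<lambda>x. F *v x + b)"
  shows "hqc_solution \<epsilon> m p \<R> V u T (\<epsilon> *\<^sub>R z) RT \<longleftrightarrow>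
    (\<lambda>x. RT x - (F *v x + b)) \<in> hqc_space \<epsilon> m p (\<epsilon> *\<^sub>R z) \<and>
    (\<forall>s. reduced_variation V F (site_values \<epsilon> z (\<lambda>x. RT x - (F *v x + b))) s = 0)"
    (is "_ \<longleftrightarrow> ?R")
proof
  assume sol: "hqc_solution \<epsilon> m p \<R> V u T (\<epsilon> *\<^sub>R z) RT"
  then have RT: "(\<lambda>x. RT x - (F *v x + b)) \<in> hqc_space \<epsilon> m p (\<epsilon> *\<^sub>R z)"
    by (simp add: hqc_solution_def ext)
  let ?c = "site_values \<epsilon> z (\<lambda>x. RT x - (F *v x + b))"
  have "reduced_variation V F ?c s = 0" for s
  proof -
    let ?t = "\<lambda>x. \<epsilon> *\<^sub>R cell_extension s (x /\<^sub>R \<epsilon>)"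
    have t: "?t \<in> hqc_space \<epsilon> m p (\<epsilon> *\<^sub>R z)"
      by (rule scaled_cell_extension_in_hqc_space[OF \<epsilon> z])
    have "(1 / real m) * reduced_variation V F ?c (site_values \<epsilon> z ?t) = 0"
      unfolding hqc_variation_eq_reduced[OF \<epsilon> z RT t, symmetric]
      using sol t unfolding hqc_solution_def by blast
    moreover have "reduced_variation V F ?c (site_values \<epsilon> z ?t)
        = reduced_variation V F ?c (\<lambda>\<alpha>. s \<alpha> - mean s)"
      by (rule reduced_variation_cong) (simp_all add: site_values_scaled_cell_extension[OF \<epsilon> z])
    ultimately show ?thesis
      using m_pos by (simp add: reduced_variation_shift_test)
  qed
  with RT show ?R by simp
next
  assume R: ?R
  then have RT: "(\<lambda>x. RT x - (F *v x + b)) \<in> hqc_space \<epsilon> m p (\<epsilon> *\<^sub>R z)" ..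
  show "hqc_solution \<epsilon> m p \<R> V u T (\<epsilon> *\<^sub>R z) RT"
    unfolding hqc_solution_def ext
    using R by (auto simp only: hqc_variation_eq_reduced[OF \<epsilon> z RT] mult_zero_right)
qed

lemma hqc_energy_eq_reduced:
  assumes \<epsilon>: "\<epsilon> > 0" and z: "z \<in> int_lattice"
    and RT: "(\<lambda>x. RT x - (F *v x + b)) \<in> hqc_space \<epsilon> m p (\<epsilon> *\<^sub>R z)"
  shows "average (sampling_domain \<epsilon> m p (\<epsilon> *\<^sub>R z))
       (\<lambda>x. V (species m p (x /\<^sub>R \<epsilon>)) (hqc_tuple \<epsilon> m p \<R> RT x))
    = (1 / real m) * (\<Sum>\<beta><m. V \<beta>
        (reduced_tuple F (site_values \<epsilon> z (\<lambda>x. RT x - (F *v x + b))) \<beta>))"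
  by (simp add: average_sampling_domain[OF \<epsilon>] species_sampling[OF \<epsilon> z]
      hqc_tuple_eq_reduced[OF \<epsilon> z _ RT])

lemma hqc_elem_energy_eq_reduced:
  assumes \<epsilon>: "\<epsilon> > 0" and z: "z \<in> int_lattice" and ext: "affine_ext T u = (\<lambda>x. F *v x + b)"
  shows "hqc_elem_energy \<epsilon> m p \<R> V u T (\<epsilon> *\<^sub>R z) = reduced_energies V F"
proof (intro equalityI subsetI)
  fix E assume "E \<in> hqc_elem_energy \<epsilon> m p \<R> V u T (\<epsilon> *\<^sub>R z)"
  then obtain RT where sol: "hqc_solution \<epsilon> m p \<R> V u T (\<epsilon> *\<^sub>R z) RT"
    and E: "E = average (sampling_domain \<epsilon> m p (\<epsilon> *\<^sub>R z))
       (\<lambda>x. V (species m p (x /\<^sub>R \<epsilon>)) (hqc_tuple \<epsilon> m p \<R> RT x))"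
    unfolding hqc_elem_energy_def by blast
  from sol have RT: "(\<lambda>x. RT x - (F *v x + b)) \<in> hqc_space \<epsilon> m p (\<epsilon> *\<^sub>R z)"
    and crit: "\<forall>s. reduced_variation V F (site_values \<epsilon> z (\<lambda>x. RT x - (F *v x + b))) s = 0"
    unfolding hqc_solution_iff_reduced[OF \<epsilon> z ext] by blast+
  show "E \<in> reduced_energies V F"
    unfolding reduced_energies_def E hqc_energy_eq_reduced[OF \<epsilon> z RT] using crit by blast
next
  fix E assume "E \<in> reduced_energies V F"
  then obtain c where c: "\<forall>s. reduced_variation V F c s = 0"
    and E: "E = (1 / real m) * (\<Sum>\<beta><m. V \<beta> (reduced_tuple F c \<beta>))"
    by (auto simp: reduced_energies_def)
  let ?s = "\<lambda>x. \<epsilon> *\<^sub>R cell_extension c (x /\<^sub>R \<epsilon>)"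
  define RT where "RT x = (F *v x + b) + ?s x" for x
  have RT_diff: "(\<lambda>x. RT x - (F *v x + b)) = ?s"
    by (simp add: RT_def fun_eq_iff)
  have RT: "(\<lambda>x. RT x - (F *v x + b)) \<in> hqc_space \<epsilon> m p (\<epsilon> *\<^sub>R z)"
    unfolding RT_diff by (rule scaled_cell_extension_in_hqc_space[OF \<epsilon> z])
  have "reduced_variation V F (site_values \<epsilon> z ?s) s
      = reduced_variation V F (\<lambda>\<alpha>. c \<alpha> - mean c) s" for s
    by (rule reduced_variation_cong) (simp_all add: site_values_scaled_cell_extension[OF \<epsilon> z])
  then have "hqc_solution \<epsilon> m p \<R> V u T (\<epsilon> *\<^sub>R z) RT"
    unfolding hqc_solution_iff_reduced[OF \<epsilon> z ext] using RT c
    by (simp add: RT_diff reduced_variation_shift)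
  moreover have "reduced_tuple F (site_values \<epsilon> z ?s) \<beta> = reduced_tuple F c \<beta>" if "\<beta> < m" for \<beta>
    using that reduced_tuple_cong[of "site_values \<epsilon> z ?s" "\<lambda>\<alpha>. c \<alpha> - mean c" \<beta>]
    by (simp add: site_values_scaled_cell_extension[OF \<epsilon> z] reduced_tuple_shift)
  then have "E = average (sampling_domain \<epsilon> m p (\<epsilon> *\<^sub>R z))
       (\<lambda>x. V (species m p (x /\<^sub>R \<epsilon>)) (hqc_tuple \<epsilon> m p \<R> RT x))"
    unfolding hqc_energy_eq_reduced[OF \<epsilon> z RT] by (simp add: E RT_diff)
  ultimately show "E \<in> hqc_elem_energy \<epsilon> m p \<R> V u T (\<epsilon> *\<^sub>R z)"
    unfolding hqc_elem_energy_def by blast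
qed

section \<open>The shift-vector equations\<close>

text \<open>Shift vectors fix the additive constant by giving species \<open>0\<close> the displacement \<open>0\<close>. The
  difference quotients of the indicators carry a factor \<open>1 / \<epsilon>\<close>.\<close>

definition shift_displacement :: "real \<Rightarrow> (nat \<Rightarrow> real^'d) \<Rightarrow> nat \<Rightarrow> real^'d"
  where "shift_displacement \<epsilon> q \<alpha> = (if \<alpha> = 0 then 0 else q \<alpha> /\<^sub>R \<epsilon>)"

lemma diff_quot_indicator:
  assumes "\<epsilon> > 0" "\<beta> < m" "r \<in> \<R> \<beta>"
  shows "diff_quot \<epsilon> r (species_indicator \<epsilon> m p \<alpha>) (\<epsilon> *\<^sub>R p \<beta>)
    = (of_bool (neighbour_species \<beta> r = \<alpha>) - of_bool (\<beta> = \<alpha>)) / \<epsilon>"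
proof -
  have "species m p ((\<epsilon> *\<^sub>R p \<beta> + \<epsilon> *\<^sub>R r) /\<^sub>R \<epsilon>) = neighbour_species \<beta> r"
    using assms by (simp add: scaleR_add_right[of "inverse \<epsilon>"] neighbour_species_def)
  moreover have "species m p ((\<epsilon> *\<^sub>R p \<beta>) /\<^sub>R \<epsilon>) = \<beta>"
    using species_sampling[OF assms(1) zero_in_int_lattice assms(2)] by simp
  ultimately show ?thesis
    by (simp add: diff_quot_def species_indicator_def)
qed

lemma sum_of_bool_shift:
  assumes "\<beta> < m"
  shows "(\<Sum>\<alpha> = 1..<m. (of_bool (\<beta> = \<alpha>) / \<epsilon>) *\<^sub>R q \<alpha>) = shift_displacement \<epsilon> q \<beta>"
proof -
  have "(\<Sum>\<alpha> = 1..<m. (of_bool (\<beta> = \<alpha>) / \<epsilon>) *\<^sub>R q \<alpha>)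
      = (\<Sum>\<alpha> = 1..<m. if \<beta> = \<alpha> then q \<alpha> /\<^sub>R \<epsilon> else 0)"
    by (intro sum.cong) (auto simp: divide_inverse)
  then show ?thesis
    using assms by (auto simp: shift_displacement_def)
qed

lemma mqc_tuple_eq_reduced:
  assumes \<epsilon>: "\<epsilon> > 0" and \<beta>: "\<beta> < m"
  shows "mqc_tuple \<epsilon> m p \<R> F \<beta> q = reduced_tuple F (shift_displacement \<epsilon> q) \<beta>"
proof -
  have "(\<Sum>\<alpha> = 1..<m. diff_quot \<epsilon> r (species_indicator \<epsilon> m p \<alpha>) (\<epsilon> *\<^sub>R p \<beta>) *\<^sub>R q \<alpha>)
      = shift_displacement \<epsilon> q (neighbour_species \<beta> r) - shift_displacement \<epsilon> q \<beta>"
    if r: "r \<in> \<R> \<beta>" for r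
  proof -
    have "neighbour_species \<beta> r < m"
      using neighbour_cases[OF \<beta> r] by metis
    then show ?thesis
      unfolding diff_quot_indicator[OF \<epsilon> \<beta> r] diff_divide_distrib scaleR_diff_left sum_subtractf
      using \<beta> by (simp only: sum_of_bool_shift)
  qed
  then show ?thesis
    by (auto simp: mqc_tuple_def reduced_tuple_def fun_eq_iff)
qed

text \<open>The equation for species \<open>\<gamma>\<close>, tested with a vector \<open>v\<close>, is the reduced variation for the test
  values that are \<open>v\<close> on species \<open>\<gamma>\<close> and zero elsewhere.\<close>

lemma inner_shift_equation:
  assumes \<epsilon>: "\<epsilon> > 0"
  shows "(\<Sum>\<beta><m. \<Sum>r \<in> \<R> \<beta>. diff_quot \<epsilon> r (species_indicator \<epsilon> m p \<gamma>) (\<epsilon> *\<^sub>R p \<beta>) *\<^sub>R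
            partial_grad (V \<beta>) r (mqc_tuple \<epsilon> m p \<R> F \<beta> q)) \<bullet> v
    = reduced_variation V F (shift_displacement \<epsilon> q) (\<lambda>\<alpha>. of_bool (\<alpha> = \<gamma>) *\<^sub>R v) / \<epsilon>"
proof -
  have "diff_quot \<epsilon> r (species_indicator \<epsilon> m p \<gamma>) (\<epsilon> *\<^sub>R p \<beta>) *\<^sub>R
            partial_grad (V \<beta>) r (mqc_tuple \<epsilon> m p \<R> F \<beta> q) \<bullet> v
    = partial_grad (V \<beta>) r (reduced_tuple F (shift_displacement \<epsilon> q) \<beta>) \<bullet>
      (of_bool (neighbour_species \<beta> r = \<gamma>) *\<^sub>R v - of_bool (\<beta> = \<gamma>) *\<^sub>R v) / \<epsilon>"
    if "\<beta> < m" "r \<in> \<R> \<beta>" for \<beta> r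
    using that by (simp add: diff_quot_indicator[OF \<epsilon>] mqc_tuple_eq_reduced[OF \<epsilon>]
        flip: scaleR_diff_left)
  then show ?thesis
    by (simp add: reduced_variation_def inner_sum_left sum_divide_distrib)
qed

text \<open>Arbitrary test values reduce to test values vanishing on species \<open>0\<close>, because a constant can
  be subtracted from them; those are sums of test values supported on a single species.\<close>

lemma mqc_solution_iff_reduced:
  assumes \<epsilon>: "\<epsilon> > 0"
  shows "mqc_solution \<epsilon> m p \<R> V F q \<longleftrightarrow>
    (\<forall>s. reduced_variation V F (shift_displacement \<epsilon> q) s = 0)" (is "_ \<longleftrightarrow> ?R")
proof -
  let ?c = "shift_displacement \<epsilon> q"
  have "mqc_solution \<epsilon> m p \<R> V F q \<longleftrightarrow>
    (\<forall>\<gamma>\<in>{1..<m}. \<forall>v. reduced_variation V F ?c (\<lambda>\<alpha>. of_bool (\<alpha> = \<gamma>) *\<^sub>R v) = 0)" (is "_ \<longleftrightarrow> ?Q")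
  proof -
    have iff: "(1 / real m) *\<^sub>R w = 0 \<longleftrightarrow> (\<forall>v. w \<bullet> v = 0)" for w :: "real^'d"
      using m_pos by (auto dest: spec[of _ w])
    show ?thesis
      unfolding mqc_solution_def iff inner_shift_equation[OF \<epsilon>] using \<epsilon> by simp
  qed
  also have "?Q \<longleftrightarrow> ?R"
  proof
    assume Q: ?Q
    show ?R
    proof
      fix s
      have "reduced_variation V F ?c s = reduced_variation V F ?c (\<lambda>\<alpha>. s \<alpha> - s 0)"
        by (simp add: reduced_variation_shift_test)
      also have "\<dots> = reduced_variation V F ?c
          (\<lambda>\<alpha>. \<Sum>\<gamma>\<in>{1..<m}. of_bool (\<alpha> = \<gamma>) *\<^sub>R (s \<gamma> - s 0))"
      proof (rule reduced_variation_cong)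
        fix \<alpha> assume "\<alpha> < m"
        then show "s \<alpha> - s 0 = (\<Sum>\<gamma>\<in>{1..<m}. of_bool (\<alpha> = \<gamma>) *\<^sub>R (s \<gamma> - s 0))"
          using sum_of_bool_shift[of \<alpha> 1 "\<lambda>\<gamma>. s \<gamma> - s 0"]
          by (simp add: shift_displacement_def split: if_splits)
      qed simp
      also have "\<dots> = 0"
        using Q by (simp add: reduced_variation_sum_test)
      finally show "reduced_variation V F ?c s = 0" .
    qed
  qed simp
  finally show ?thesis .
qed

lemma mqc_elem_energy_eq_reduced:
  assumes \<epsilon>: "\<epsilon> > 0"
  shows "mqc_elem_energy \<epsilon> m p \<R> V F = reduced_energies V F"
proof (intro equalityI subsetI)
  fix E assume "E \<in> mqc_elem_energy \<epsilon> m p \<R> V F"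
  then show "E \<in> reduced_energies V F"
    by (auto simp: mqc_elem_energy_def reduced_energies_def mqc_solution_iff_reduced[OF \<epsilon>]
        mqc_tuple_eq_reduced[OF \<epsilon>])
next
  fix E assume "E \<in> reduced_energies V F"
  then obtain c where c: "\<forall>s. reduced_variation V F c s = 0"
    and E: "E = (1 / real m) * (\<Sum>\<beta><m. V \<beta> (reduced_tuple F c \<beta>))"
    by (auto simp: reduced_energies_def)
  define q where "q \<alpha> = \<epsilon> *\<^sub>R (c \<alpha> - c 0)" for \<alpha>
  have disp: "shift_displacement \<epsilon> q = (\<lambda>\<alpha>. c \<alpha> - c 0)"
    using \<epsilon> by (auto simp: shift_displacement_def q_def)
  have "mqc_solution \<epsilon> m p \<R> V F q"
    using c by (simp add: mqc_solution_iff_reduced[OF \<epsilon>] disp reduced_variation_shift)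
  moreover have "E = (1 / real m) * (\<Sum>\<beta><m. V \<beta> (mqc_tuple \<epsilon> m p \<R> F \<beta> q))"
    by (simp add: E mqc_tuple_eq_reduced[OF \<epsilon>] disp reduced_tuple_shift)
  ultimately show "E \<in> mqc_elem_energy \<epsilon> m p \<R> V F"
    unfolding mqc_elem_energy_def by blast
qed

end

section \<open>Affine functions on an element\<close>

lemma full_simplex_interior_nonempty:
  fixes S :: "(real^'d) set"
  assumes "int CARD('d) simplex S"
  shows "interior S \<noteq> {}"
proof -
  have "aff_dim S = DIM(real^'d)" "convex S" "S \<noteq> {}"
    using assms aff_dim_simplex convex_simplex by (fastforce simp: simplex_def)+
  then show ?thesis
    by (metis interior_rel_interior_gen rel_interior_eq_empty)
qed

text \<open>Derivatives within a thin set are not unique; at an interior point the gradient is the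
  ordinary derivative, and that determines it.\<close>

lemma elem_grad_affine:
  assumes int: "x0 \<in> interior T" and u: "\<forall>x\<in>T. u x = F *v x + b"
  shows "elem_grad T u = F"
  unfolding elem_grad_def
proof (rule the_equality)
  show "\<forall>x\<in>T. (u has_derivative (*v) F) (at x within T)"
  proof
    fix x assume x: "x \<in> T"
    have "((\<lambda>x. F *v x + b) has_derivative (*v) F) (at x within T)"
      by (auto intro!: derivative_eq_intros bounded_linear_imp_has_derivative)
    then show "(u has_derivative (*v) F) (at x within T)"
      by (rule has_derivative_transform[OF x, rotated]) (use u in simp)
  qed
  then have F: "(u has_derivative (*v) F) (at x0)"
    using int by (metis at_within_interior interior_subset subsetD)
  fix A assume "\<forall>x\<in>T. (u has_derivative (*v) A) (at x within T)"
  then have "(u has_derivative (*v) A) (at x0)"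
    using int by (metis at_within_interior interior_subset subsetD)
  then have "(*v) A = (*v) F"
    using F has_derivative_unique by blast
  then show "A = F"
    by (simp add: matrix_eq fun_eq_iff)
qed

lemma affine_ext_affine:
  assumes int: "x0 \<in> interior T" and u: "\<forall>x\<in>T. u x = F *v x + b"
  shows "affine_ext T u = (\<lambda>x. F *v x + b)"
  unfolding affine_ext_def
proof (rule the_equality)
  show "affine_fun_on UNIV (\<lambda>x. F *v x + b) \<and> (\<forall>x\<in>T. F *v x + b = u x)"
    using u matrix_vector_mul_linear by (auto simp: affine_fun_on_def)
next
  fix v assume v: "affine_fun_on UNIV v \<and> (\<forall>x\<in>T. v x = u x)"
  then obtain L c where L: "linear L" and vL: "\<And>x. v x = L x + c"
    by (auto simp: affine_fun_on_def)
  have mat: "L x = matrix L *v x" for x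
    using L by (simp add: matrix_works)
  \<comment> \<open>The linear parts agree because both compute the gradient on the element.\<close>
  have "\<forall>x\<in>T. u x = matrix L *v x + c"
    using v vL mat by metis
  then have "matrix L = F"
    using elem_grad_affine[OF int u] elem_grad_affine[OF int, of u "matrix L" c] by simp
  moreover have "F *v x0 + c = F *v x0 + b"
    using v u vL[of x0] mat[of x0] \<open>matrix L = F\<close> int interior_subset[of T] by auto
  ultimately show "v = (\<lambda>x. F *v x + b)"
    using vL mat by auto
qed

lemma fe_function_on_element:
  assumes "unit_cell_triangulation \<T>" "u \<in> fe_space \<T>" "T \<in> \<T>"
  obtains b where "affine_ext T u = (\<lambda>x. elem_grad T u *v x + b)"
proof -
  have "int CARD('a) simplex (closure T)" "interior (closure T) \<subseteq> T"
    using assms(1,3) by (auto simp: unit_cell_triangulation_def)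
  then obtain x0 where x0: "x0 \<in> interior T"
    using full_simplex_interior_nonempty interior_maximal open_interior by blast
  have "affine_fun_on T u"
    using assms(2,3) by (simp add: fe_space_def)
  then obtain L b where "linear L" "\<forall>x\<in>T. u x = L x + b"
    unfolding affine_fun_on_def by blast
  then have "\<forall>x\<in>T. u x = matrix L *v x + b"
    by (simp add: matrix_works)
  from affine_ext_affine[OF x0 this] elem_grad_affine[OF x0 this] show ?thesis
    by (intro that[of b]) simp
qed

section \<open>Equality of the three energies\<close>

theorem theorem6p1:
  fixes \<epsilon> :: real and m :: nat
    and p :: "nat \<Rightarrow> real^'d"
    and \<R> :: "nat \<Rightarrow> (real^'d) set"
    and V :: "nat \<Rightarrow> (real^'d \<Rightarrow> real^'d) \<Rightarrow> real"
    and \<T> :: "(real^'d) set set"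
    and xrep :: "(real^'d) set \<Rightarrow> real^'d"
    and u :: "real^'d \<Rightarrow> real^'d"
  assumes "\<epsilon> > 0" and "1 / \<epsilon> \<in> \<nat>"
    and "m \<ge> 1" and "p 0 = 0" and "inj_on p {..<m}" and "\<And>\<alpha>. \<alpha> < m \<Longrightarrow> p \<alpha> \<in> unit_cell"
    and "\<And>\<alpha>. \<alpha> < m \<Longrightarrow> finite (\<R> \<alpha>)"
    and "\<And>\<alpha> r. \<alpha> < m \<Longrightarrow> r \<in> \<R> \<alpha> \<Longrightarrow> p \<alpha> + r \<in> sites m p"
    and "\<And>\<alpha>. \<alpha> < m \<Longrightarrow> tuple_differentiable (\<R> \<alpha>) (V \<alpha>)"
    and "unit_cell_triangulation \<T>"
    and "\<And>T. T \<in> \<T> \<Longrightarrow> xrep T \<in> lattice \<epsilon>"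
    and "u \<in> fe_space \<T>"
  shows "E_hqc \<epsilon> m p \<R> V \<T> xrep u = E_hom m p \<R> V \<T> u \<and>
         E_hom m p \<R> V \<T> u = E_mqc \<epsilon> m p \<R> V \<T> u"
proof -
  interpret multilattice m p \<R>
    using assms(3,5,6,8) by unfold_locales auto
  have "hqc_elem_energy \<epsilon> m p \<R> V u T (xrep T) = reduced_energies V (elem_grad T u)"
    if T: "T \<in> \<T>" for T
  proof -
    obtain z where "z \<in> int_lattice" "xrep T = \<epsilon> *\<^sub>R z"
      using assms(11)[OF T] by (auto simp: lattice_def)
    moreover obtain b where "affine_ext T u = (\<lambda>x. elem_grad T u *v x + b)"
      using fe_function_on_element[OF assms(10,12) T] .
    ultimately show ?thesis
      using hqc_elem_energy_eq_reduced[OF assms(1)] by metis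
  qed
  then show ?thesis
    by (simp add: E_hqc_def E_hom_def E_mqc_def total_energy_def
        hom_energy_density_eq_reduced mqc_elem_energy_eq_reduced[OF assms(1)])
qed

end
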